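(* Let $\xi$ be a swap-invariant random vector (in $\mathbb{R}^n$ for some $n\ge1$) whose coordinates take only values $a$ and $b$, where $a,b\in\mathbb{R}$ with $|a|\neq|b|$. Then $\xi$ is exchangeable.
   Context: A random vector $\xi=(\xi_1,\dots,\xi_n)$ of integrable random variables is swap-invariant if for every permutation $\pi$ of $\{1,\dots,n\}$ and every $u\in\mathbb{R}^n$, $$\mathbf{E}\,\Big|\sum_{j=1}^n u_j\xi_j\Big|=\mathbf{E}\,\Big|\sum_{j=1}^n u_j\xi_{\pi(j)}\Big|.$$ It is exchangeable if $(\xi_{\pi(1)},\dots,\xi_{\pi(n)})$ has the same distribution as $(\xi_1,\dots,\xi_n)$ for every permutation $\pi$ of $\{1,\dots,n\}$. *)

theory Defs
  imports "HOL-Probability.Probability"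
begin

text \<open>
  A random vector in n-dimensional space is a map \<open>\<xi> :: 'a \<Rightarrow> real ^ 'n\<close> on a probability space
  \<open>M\<close>, with n the cardinality of the finite index type \<open>'n\<close>; a permutation of the indices is a
  \<open>\<pi>\<close> with \<open>\<pi> permutes UNIV\<close>.
\<close>

definition permute_coords :: "('n::finite \<Rightarrow> 'n) \<Rightarrow> real ^ 'n \<Rightarrow> real ^ 'n" where
  "permute_coords \<pi> x = (\<chi> j. x $ \<pi> j)"

definition swap_invariant :: "'a measure \<Rightarrow> ('a \<Rightarrow> real ^ 'n::finite) \<Rightarrow> bool" where
  "swap_invariant M \<xi> \<longleftrightarrow>
     (\<forall>j. integrable M (\<lambda>\<omega>. \<xi> \<omega> $ j)) \<and>
     (\<forall>\<pi>. \<pi> permutes UNIV \<longrightarrow>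
       (\<forall>u :: real ^ 'n.
         (\<integral>\<omega>. \<bar>\<Sum>j\<in>UNIV. u $ j * \<xi> \<omega> $ j\<bar> \<partial>M) =
         (\<integral>\<omega>. \<bar>\<Sum>j\<in>UNIV. u $ j * \<xi> \<omega> $ \<pi> j\<bar> \<partial>M)))"

text \<open>
  Measurability is part of the definition because \<open>distr\<close> is only meaningful for measurable maps.
\<close>

definition exchangeable :: "'a measure \<Rightarrow> ('a \<Rightarrow> real ^ 'n::finite) \<Rightarrow> bool" where
  "exchangeable M \<xi> \<longleftrightarrow>
     \<xi> \<in> borel_measurable M \<and>
     (\<forall>\<pi>. \<pi> permutes UNIV \<longrightarrow>
       distr M borel (\<lambda>\<omega>. permute_coords \<pi> (\<xi> \<omega>)) = distr M borel \<xi>)"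

end

theory Submission
  imports Defs
begin

text \<open>
  The functions \<open>u \<mapsto> \<bar>u \<bullet> x\<bar>\<close>, for pairwise non-proportional nonzero vectors \<open>x\<close>, are linearly
  independent: near a generic point of the hyperplane orthogonal to \<open>y\<close>, only the term of \<open>y\<close> fails to be
  affine, so a second difference isolates its coefficient.
  The vectors with entries in \<open>{a, b}\<close> are pairwise non-proportional when \<open>\<bar>a\<bar> \<noteq> \<bar>b\<bar>\<close>, apart from the two
  constant ones, whose masses are trivially permutation invariant. Hence swap-invariance
  determines every point mass of the permuted vector.
\<close>

text \<open>A real subspace is not a finite union of proper subspaces. By induction, a vector
  \<open>u\<close> that works for \<open>F\<close> is moved slightly along a \<open>w\<close> that
  works for the new point.\<close>

lemma exists_common_nonzero_inner:
  fixes F :: "'v::real_inner set"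
  assumes "finite F" and "subspace V"
    and "\<And>x. x \<in> F \<Longrightarrow> \<exists>u\<in>V. u \<bullet> x \<noteq> 0"
  shows "\<exists>u\<in>V. \<forall>x\<in>F. u \<bullet> x \<noteq> 0"
  using assms(1,3)
proof (induction F rule: finite_induct)
  case empty
  then show ?case using subspace_0[OF assms(2)] by auto
next
  case (insert y F)
  obtain u where u: "u \<in> V" "\<forall>x\<in>F. u \<bullet> x \<noteq> 0" using insert by blast
  obtain w where w: "w \<in> V" "w \<bullet> y \<noteq> 0" using insert.prems by blast
  \<comment> \<open>Each \<open>x\<close> forbids at most one value of \<open>e\<close>: if
    \<open>w\<close> is orthogonal to \<open>x\<close>, then \<open>x\<close> lies in
    \<open>F\<close> and \<open>u\<close> already gives a nonzero product; otherwise the condition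
    is a linear equation in \<open>e\<close>.\<close>
  have "finite {e. (u + e *\<^sub>R w) \<bullet> x = 0}" if x: "x \<in> insert y F" for x
  proof (cases "w \<bullet> x = 0")
    case True
    with x u w show ?thesis by (auto simp: inner_add_left)
  next
    case False
    then have "{e. (u + e *\<^sub>R w) \<bullet> x = 0} \<subseteq> {- (u \<bullet> x) / (w \<bullet> x)}"
      by (auto simp: inner_add_left field_simps)
    then show ?thesis by (rule finite_subset) simp
  qed
  then have "finite (\<Union>x\<in>insert y F. {e. (u + e *\<^sub>R w) \<bullet> x = 0})"
    using insert.hyps by blast
  then obtain e where "e \<notin> (\<Union>x\<in>insert y F. {e. (u + e *\<^sub>R w) \<bullet> x = 0})"
    using ex_new_if_finite[OF infinite_UNIV_char_0] by blast
  then have "\<forall>x\<in>insert y F. (u + e *\<^sub>R w) \<bullet> x \<noteq> 0" by blast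
  moreover have "u + e *\<^sub>R w \<in> V"
    using u w assms(2) by (simp add: subspace_add subspace_scale)
  ultimately show ?case by blast
qed

text \<open>The witness is the component of \<open>x\<close> orthogonal to \<open>y\<close>; its
  product with \<open>x\<close> is its own squared norm, which is positive because \<open>x\<close>
  is not a multiple of \<open>y\<close>.\<close>

lemma exists_orthogonal_nonorthogonal:
  fixes x y :: "'v::real_inner"
  assumes "y \<noteq> 0" and "\<And>k. x \<noteq> k *\<^sub>R y"
  shows "\<exists>u. u \<bullet> y = 0 \<and> u \<bullet> x \<noteq> 0"
proof -
  define u where "u = x - ((x \<bullet> y) / (y \<bullet> y)) *\<^sub>R y"
  have uy: "u \<bullet> y = 0" using assms(1) by (simp add: u_def inner_diff_left)
  have "u \<bullet> x = u \<bullet> u" using uy by (simp add: u_def inner_diff_right)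
  moreover have "u \<noteq> 0" using assms(2) by (auto simp: u_def)
  ultimately show ?thesis using uy by auto
qed

lemma abs_inner_independent:
  fixes F :: "'v::real_inner set" and q :: "'v \<Rightarrow> real"
  assumes "finite F" and y: "y \<in> F" "y \<noteq> 0"
    and nonprop: "\<And>x k. x \<in> F \<Longrightarrow> x \<noteq> y \<Longrightarrow> x \<noteq> k *\<^sub>R y"
    and zero: "\<And>u. (\<Sum>x\<in>F. q x * \<bar>u \<bullet> x\<bar>) = 0"
  shows "q y = 0"
proof -
  have "\<exists>u\<in>{u. u \<bullet> y = 0}. u \<bullet> x \<noteq> 0" if "x \<in> F - {y}" for x
    using exists_orthogonal_nonorthogonal[of y x] y nonprop that by blast
  moreover have "subspace {u. u \<bullet> y = 0}"
    by (auto simp: subspace_def inner_add_left)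
  ultimately obtain u where u: "u \<bullet> y = 0" "\<forall>x\<in>F - {y}. u \<bullet> x \<noteq> 0"
    using exists_common_nonzero_inner[of "F - {y}" "{u. u \<bullet> y = 0}"] assms(1) by blast
  \<comment> \<open>The sum dominates each of its ratios, so \<open>K *\<^sub>R u\<close> is far
    enough out that moving by \<open>y\<close> in either direction never crosses the hyperplane
    orthogonal to any other \<open>x\<close>.\<close>
  define K where "K = (\<Sum>x\<in>F - {y}. \<bar>y \<bullet> x\<bar> / \<bar>u \<bullet> x\<bar>)"
  have small: "\<bar>y \<bullet> x\<bar> \<le> \<bar>(K *\<^sub>R u) \<bullet> x\<bar>" if "x \<in> F - {y}" for x
  proof -
    have "\<bar>y \<bullet> x\<bar> / \<bar>u \<bullet> x\<bar> \<le> K"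
      unfolding K_def using assms(1) that by (intro member_le_sum) auto
    then have "\<bar>y \<bullet> x\<bar> \<le> K * \<bar>u \<bullet> x\<bar>"
      using u(2) that by (simp add: pos_divide_le_eq)
    also have "\<dots> \<le> \<bar>(K *\<^sub>R u) \<bullet> x\<bar>"
      by (simp add: abs_mult mult_right_mono)
    finally show ?thesis .
  qed
  \<comment> \<open>Second difference at \<open>K *\<^sub>R u\<close> with step \<open>y\<close>: it
    vanishes where no sign changes, while at \<open>x = y\<close> the base point sits exactly on the
    kink.\<close>
  let ?D = "\<lambda>x. \<bar>(K *\<^sub>R u + y) \<bullet> x\<bar> + \<bar>(K *\<^sub>R u - y) \<bullet> x\<bar> - 2 * \<bar>(K *\<^sub>R u) \<bullet> x\<bar>"
  have D0: "?D x = 0" if "x \<in> F - {y}" for x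
    using small[OF that] unfolding inner_add_left inner_diff_left by linarith
  have "(\<Sum>x\<in>F. q x * (f x + g x - 2 * h x))
      = (\<Sum>x\<in>F. q x * f x) + (\<Sum>x\<in>F. q x * g x) - 2 * (\<Sum>x\<in>F. q x * h x)"
    for f g h :: "'v \<Rightarrow> real"
    unfolding sum_distrib_left sum.distrib[symmetric] sum_subtractf[symmetric]
    by (intro sum.cong) (auto simp: algebra_simps)
  from this[of "\<lambda>x. \<bar>(K *\<^sub>R u + y) \<bullet> x\<bar>" "\<lambda>x. \<bar>(K *\<^sub>R u - y) \<bullet> x\<bar>" "\<lambda>x. \<bar>(K *\<^sub>R u) \<bullet> x\<bar>"]
  have "0 = (\<Sum>x\<in>F. q x * ?D x)"
    unfolding zero by simp
  also have "\<dots> = q y * ?D y + (\<Sum>x\<in>F - {y}. q x * ?D x)"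
    using assms(1) y(1) by (rule sum.remove)
  also have "(\<Sum>x\<in>F - {y}. q x * ?D x) = 0"
    using D0 by (intro sum.neutral) simp
  also have "?D y = 2 * (y \<bullet> y)"
    using u(1) by (simp add: inner_add_left inner_diff_left)
  finally show ?thesis using y(2) by simp
qed

text \<open>At \<open>i\<close> and \<open>j\<close> both vectors show both values, so their entries
  there either agree, forcing \<open>k = 1\<close>, or are swapped, forcing equal squares.
  Non-constancy matters: of the two constant vectors, one is always a multiple of the other.\<close>

lemma two_valued_nonproportional:
  fixes x y :: "real ^ 'n" and a b :: real
  assumes x: "\<forall>j. x $ j = a \<or> x $ j = b" and y: "\<forall>j. y $ j = a \<or> y $ j = b"
    and ab: "\<bar>a\<bar> \<noteq> \<bar>b\<bar>" and nonconst: "x $ i \<noteq> x $ j" and k: "x = k *\<^sub>R y"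
  shows "x = y"
proof -
  have eq: "x $ i = k * y $ i" "x $ j = k * y $ j" using k by simp_all
  have "y $ i \<noteq> y $ j" using eq nonconst by auto
  then have abs: "\<bar>y $ i\<bar> \<noteq> \<bar>y $ j\<bar>" using y ab by metis
  consider "x $ i = y $ i" "x $ j = y $ j" | "x $ i = y $ j" "x $ j = y $ i"
    using x y nonconst \<open>y $ i \<noteq> y $ j\<close> by metis
  then show ?thesis
  proof cases
    case 1
    have "y $ i \<noteq> 0 \<or> y $ j \<noteq> 0" using \<open>y $ i \<noteq> y $ j\<close> by auto
    then have "k = 1" using 1 eq by auto
    then show ?thesis using k by simp
  next
    case 2
    \<comment> \<open>Here \<open>y $ j = k * y $ i\<close> and \<open>y $ i = k * y $ j\<close>, so
      both squares equal \<open>k * y $ i * y $ j\<close>.\<close>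
    then have "y $ i * y $ i = y $ j * y $ j"
      using eq by (metis mult.commute mult.left_commute)
    then show ?thesis using abs by (metis abs_eq_iff square_eq_iff)
  qed
qed

lemma finite_two_valued: "finite {x :: real ^ 'n::finite. \<forall>j. x $ j = a \<or> x $ j = b}"
proof -
  have "{x :: real ^ 'n. \<forall>j. x $ j = a \<or> x $ j = b} \<subseteq> vec_lambda ` (UNIV \<rightarrow>\<^sub>E {a, b})"
  proof
    fix x :: "real ^ 'n" assume "x \<in> {x. \<forall>j. x $ j = a \<or> x $ j = b}"
    then have "vec_nth x \<in> UNIV \<rightarrow>\<^sub>E {a, b}" by auto
    then show "x \<in> vec_lambda ` (UNIV \<rightarrow>\<^sub>E {a, b})"
      by (metis image_eqI vec_nth_inverse)
  qed
  moreover have "finite (UNIV \<rightarrow>\<^sub>E {a, b} :: ('n \<Rightarrow> real) set)"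
    by (intro finite_PiE) auto
  ultimately show ?thesis by (meson finite_imageI finite_subset)
qed

lemma (in prob_space) expectation_finite_support:
  fixes X :: "'a \<Rightarrow> 'v::t1_space" and f :: "'v \<Rightarrow> real"
  assumes X[measurable]: "X \<in> borel_measurable M" and S: "finite S"
    and supp: "AE \<omega> in M. X \<omega> \<in> S" and f[measurable]: "f \<in> borel_measurable borel"
  shows "(\<integral>\<omega>. f (X \<omega>) \<partial>M) = (\<Sum>x\<in>S. prob (X -` {x} \<inter> space M) * f x)"
proof -
  \<comment> \<open>In a T1 space singletons are closed, hence Borel.\<close>
  have [measurable]: "X -` {x} \<inter> space M \<in> sets M" for x
    by (rule measurable_sets[OF X]) simp
  have "(\<integral>\<omega>. f (X \<omega>) \<partial>M) = (\<integral>\<omega>. (\<Sum>x\<in>S. indicator (X -` {x} \<inter> space M) \<omega> * f x) \<partial>M)"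
  proof (rule integral_cong_AE)
    show "AE \<omega> in M. f (X \<omega>) = (\<Sum>x\<in>S. indicator (X -` {x} \<inter> space M) \<omega> * f x)"
      using supp AE_space
    proof eventually_elim
      case (elim \<omega>)
      have "(\<Sum>x\<in>S. indicator (X -` {x} \<inter> space M) \<omega> * f x)
        = (\<Sum>x\<in>S. if X \<omega> = x then f x else 0)"
        using elim by (intro sum.cong) (auto simp: indicator_def)
      then show ?case using elim S by simp
    qed
  qed measurable
  also have "\<dots> = (\<Sum>x\<in>S. \<integral>\<omega>. indicator (X -` {x} \<inter> space M) \<omega> * f x \<partial>M)"
    by (intro Bochner_Integration.integral_sum integrable_mult_left integrable_real_indicator)
      (auto simp: emeasure_eq_measure)
  finally show ?thesis by simp
qed

text \<open>The probability of a Borel set is the expectation of its indicator, which the preceding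
  expansion reduces to point masses on \<open>S\<close>.\<close>

lemma (in prob_space) distr_eq_finite_support:
  fixes X Y :: "'a \<Rightarrow> 'v::t1_space"
  assumes X: "X \<in> borel_measurable M" and Y: "Y \<in> borel_measurable M" and S: "finite S"
    and suppX: "AE \<omega> in M. X \<omega> \<in> S" and suppY: "AE \<omega> in M. Y \<omega> \<in> S"
    and eq: "\<And>x. x \<in> S \<Longrightarrow> prob (X -` {x} \<inter> space M) = prob (Y -` {x} \<inter> space M)"
  shows "distr M borel X = distr M borel Y"
proof (rule measure_eqI)
  fix A assume "A \<in> sets (distr M borel X)"
  then have A: "A \<in> sets borel" by simp
  have mass: "prob (Z -` A \<inter> space M)
      = (\<Sum>x\<in>S. prob (Z -` {x} \<inter> space M) * indicator A x)"
    if Z: "Z \<in> borel_measurable M" "AE \<omega> in M. Z \<omega> \<in> S" for Z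
  proof -
    have "prob (Z -` A \<inter> space M) = (\<integral>\<omega>. indicator (Z -` A \<inter> space M) \<omega> \<partial>M)"
      by simp
    also have "\<dots> = (\<integral>\<omega>. indicator A (Z \<omega>) \<partial>M)"
      by (intro Bochner_Integration.integral_cong) (auto simp: indicator_def)
    also have "\<dots> = (\<Sum>x\<in>S. prob (Z -` {x} \<inter> space M) * indicator A x)"
      using expectation_finite_support[OF Z(1) S Z(2), of "indicator A"] A by simp
    finally show ?thesis .
  qed
  have "prob (X -` A \<inter> space M) = prob (Y -` A \<inter> space M)"
    unfolding mass[OF X suppX] mass[OF Y suppY] using eq by simp
  then show "emeasure (distr M borel X) A = emeasure (distr M borel Y) A"
    using A X Y by (simp add: emeasure_distr emeasure_eq_measure)
qed simp

theorem theorem3p1: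
  fixes M :: "'a measure"
    and \<xi> :: "'a \<Rightarrow> real ^ 'n::finite"
    and a b :: real
  assumes "prob_space M"
    and "\<xi> \<in> borel_measurable M"
    and "swap_invariant M \<xi>"
    and "AE \<omega> in M. \<forall>j. \<xi> \<omega> $ j = a \<or> \<xi> \<omega> $ j = b"
    and "\<bar>a\<bar> \<noteq> \<bar>b\<bar>"
  shows "exchangeable M \<xi>"
  unfolding exchangeable_def
proof (intro conjI allI impI)
  show "\<xi> \<in> borel_measurable M" by fact
  fix \<pi> :: "'n \<Rightarrow> 'n" assume \<pi>: "\<pi> permutes UNIV"
  interpret prob_space M by fact
  define S where "S = {x :: real ^ 'n. \<forall>j. x $ j = a \<or> x $ j = b}"
  define \<eta> where "\<eta> = (\<lambda>\<omega>. permute_coords \<pi> (\<xi> \<omega>))"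
  define q where
    "q x = prob (\<xi> -` {x} \<inter> space M) - prob (\<eta> -` {x} \<inter> space M)" for x
  have S: "finite S" unfolding S_def by (rule finite_two_valued)
  have \<xi>: "AE \<omega> in M. \<xi> \<omega> \<in> S" using assms(4) by (simp add: S_def)
  then have \<eta>: "AE \<omega> in M. \<eta> \<omega> \<in> S"
    by eventually_elim (simp add: S_def \<eta>_def permute_coords_def)
  have "continuous_on UNIV (permute_coords \<pi> :: real ^ 'n \<Rightarrow> real ^ 'n)"
    unfolding permute_coords_def by (intro continuous_intros)
  then have \<eta>_meas: "\<eta> \<in> borel_measurable M"
    unfolding \<eta>_def using assms(2) by (rule borel_measurable_continuous_on)
  \<comment> \<open>Constant vectors escape the independence argument, being proportional to each
    other; but permuting coordinates is injective and fixes them, so the two events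
    coincide.\<close>
  have const: "q x = 0" if "\<forall>i j. x $ i = x $ j" for x
  proof -
    have "\<eta> \<omega> = x \<longleftrightarrow> \<xi> \<omega> = x" for \<omega>
    proof -
      have "x $ j = x $ \<pi> j" for j using that by blast
      then have "\<eta> \<omega> = x \<longleftrightarrow> (\<forall>j. \<xi> \<omega> $ \<pi> j = x $ \<pi> j)"
        by (simp add: \<eta>_def permute_coords_def vec_eq_iff)
      also have "\<dots> \<longleftrightarrow> \<xi> \<omega> = x"
        using permutes_surj[OF \<pi>] by (metis surjD vec_eq_iff)
      finally show ?thesis .
    qed
    then have "\<eta> -` {x} = \<xi> -` {x}" by auto
    then show ?thesis by (simp add: q_def)
  qed
  \<comment> \<open>Swap-invariance equates the expectations of
    \<open>\<bar>u \<bullet> \<xi> \<omega>\<bar>\<close> and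
    \<open>\<bar>u \<bullet> \<eta> \<omega>\<bar>\<close>; expanding both over \<open>S\<close>
    gives a linear relation with coefficients \<open>q\<close>.\<close>
  have zero: "(\<Sum>x\<in>S. q x * \<bar>u \<bullet> x\<bar>) = 0" for u
  proof -
    have "(\<integral>\<omega>. \<bar>u \<bullet> \<xi> \<omega>\<bar> \<partial>M) = (\<integral>\<omega>. \<bar>u \<bullet> \<eta> \<omega>\<bar> \<partial>M)"
      using assms(3) \<pi>
      by (simp add: swap_invariant_def inner_vec_def \<eta>_def permute_coords_def)
    moreover have "(\<lambda>x. \<bar>u \<bullet> x\<bar>) \<in> borel_measurable borel" by measurable
    ultimately show ?thesis
      using expectation_finite_support[OF assms(2) S \<xi>, of "\<lambda>x. \<bar>u \<bullet> x\<bar>"]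
        expectation_finite_support[OF \<eta>_meas S \<eta>, of "\<lambda>x. \<bar>u \<bullet> x\<bar>"]
      by (simp add: q_def left_diff_distrib sum_subtractf)
  qed
  \<comment> \<open>Dropping the constant vectors, whose coefficients are zero, leaves nonzero,
    pairwise non-proportional vectors and the same relation.\<close>
  define F where "F = {x \<in> S. \<exists>i j. x $ i \<noteq> x $ j}"
  have zeroF: "(\<Sum>x\<in>F. q x * \<bar>u \<bullet> x\<bar>) = 0" for u
  proof -
    have "(\<Sum>x\<in>F. q x * \<bar>u \<bullet> x\<bar>) = (\<Sum>x\<in>S. q x * \<bar>u \<bullet> x\<bar>)"
    proof (rule sum.mono_neutral_left[OF S])
      show "F \<subseteq> S" by (auto simp: F_def)
      show "\<forall>x\<in>S - F. q x * \<bar>u \<bullet> x\<bar> = 0" using const by (simp add: F_def)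
    qed
    then show ?thesis by (simp add: zero)
  qed
  have "q y = 0" if "y \<in> S" for y
  proof (cases "y \<in> F")
    case True
    show ?thesis
    proof (rule abs_inner_independent[OF _ True _ _ zeroF])
      show "finite F" using S by (simp add: F_def)
      show "y \<noteq> 0" using True by (auto simp: F_def)
      show "x \<noteq> k *\<^sub>R y" if "x \<in> F" "x \<noteq> y" for x k
        using that two_valued_nonproportional[of x a b y _ _ k] assms(5) \<open>y \<in> S\<close>
        unfolding F_def S_def by blast
    qed
  next
    case False
    with that show ?thesis using const by (auto simp: F_def)
  qed
  then have "distr M borel \<xi> = distr M borel \<eta>"
    using distr_eq_finite_support[OF assms(2) \<eta>_meas S \<xi> \<eta>] by (simp add: q_def)
  then show "distr M borel (\<lambda>\<omega>. permute_coords \<pi> (\<xi> \<omega>)) = distr M borel \<xi>"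
    by (simp add: \<eta>_def)
qed

end
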